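(* Let $\Gamma$ be any algebraically closed directed graph that is not isomorphic to the countable universal directed graph $D$. Then there exists a non-regular injective endomorphism $f$ of $D$ such that the subgraph of $D$ induced by the images of the vertices under $f$ is isomorphic to $\Gamma$ and such that the $\mathscr{D}$-class of $f$ in $\operatorname{End} D$ contains $2^{\aleph_0}$ $\mathscr{R}$-classes and $2^{\aleph_0}$ $\mathscr{L}$-classes.
   Context: A directed graph is a pair $(V,E)$ with $E$ an irreflexive binary relation on $V$. A directed graph $(V,E)$ is algebraically closed if for every finite $A\subseteq V$ there is a vertex $v$ with $(u,v),(v,u)\in E$ for all $u\in A$. The countable universal directed graph $D$ is the Fraïssé limit of the finite directed graphs. The induced subgraph on a vertex set $U$ contains all edges of $D$ between vertices of $U$. Green's relations on $M=\operatorname{End} D$: $f\,\mathscr{L}\,g$ iff $Mf=Mg$; $f\,\mathscr{R}\,g$ iff $fM=gM$; $\mathscr{D}=\mathscr{L}\circ\mathscr{R}$. An element $f$ is regular if $fgf=f$ for some $g\in M$.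
   Formalization: The graph Γ is assumed countable; without this the claim is false, since an uncountable algebraically closed graph (e.g. the complete directed graph on an uncountable set) cannot be an induced subgraph of the countable graph D. *)

theory Defs
  imports
    "HOL-Algebra.Group"
    "HOL-Library.Countable_Set"
    "HOL-Library.Equipollence"
begin

type_synonym 'a digraph = "'a set \<times> 'a rel"

abbreviation verts :: "'a digraph \<Rightarrow> 'a set" where
  "verts \<equiv> fst"

abbreviation edges :: "'a digraph \<Rightarrow> 'a rel" where
  "edges \<equiv> snd"

definition digraph :: "'a digraph \<Rightarrow> bool" where
  "digraph G \<longleftrightarrow> edges G \<subseteq> verts G \<times> verts G \<and> irrefl (edges G)"

definition algebraically_closed :: "'a digraph \<Rightarrow> bool" where
  "algebraically_closed G \<longleftrightarrow>
     (\<forall>A. finite A \<and> A \<subseteq> verts G \<longrightarrow>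
        (\<exists>v\<in>verts G. \<forall>u\<in>A. (u, v) \<in> edges G \<and> (v, u) \<in> edges G))"

definition induced_subgraph :: "'a digraph \<Rightarrow> 'a set \<Rightarrow> 'a digraph" where
  "induced_subgraph G U = (U, edges G \<inter> U \<times> U)"

definition digraph_hom :: "'a digraph \<Rightarrow> 'b digraph \<Rightarrow> ('a \<Rightarrow> 'b) \<Rightarrow> bool" where
  "digraph_hom G H f \<longleftrightarrow>
     f \<in> verts G \<rightarrow> verts H \<and> (\<forall>(u, v)\<in>edges G. (f u, f v) \<in> edges H)"

definition digraph_iso :: "'a digraph \<Rightarrow> 'b digraph \<Rightarrow> ('a \<Rightarrow> 'b) \<Rightarrow> bool" where
  "digraph_iso G H f \<longleftrightarrow>
     bij_betw f (verts G) (verts H) \<and>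
     (\<forall>u\<in>verts G. \<forall>v\<in>verts G. (u, v) \<in> edges G \<longleftrightarrow> (f u, f v) \<in> edges H)"

definition isomorphic :: "'a digraph \<Rightarrow> 'b digraph \<Rightarrow> bool" where
  "isomorphic G H \<longleftrightarrow> (\<exists>f. digraph_iso G H f)"

text \<open>
  The Fraisse limit of the finite directed graphs: the countable homogeneous directed graph
  (every isomorphism between finite induced subgraphs extends to an automorphism) whose age
  consists of all finite directed graphs. This determines the graph up to isomorphism.
  Vertices of the finite graphs are taken in \<^typ>\<open>nat\<close>, which loses nothing up to isomorphism.
\<close>

definition universal_digraph :: "'a digraph \<Rightarrow> bool" where
  "universal_digraph D \<longleftrightarrow>
     digraph D \<and> countable (verts D) \<and>
     (\<forall>G :: nat digraph. digraph G \<and> finite (verts G) \<longrightarrow>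
        (\<exists>U\<subseteq>verts D. isomorphic G (induced_subgraph D U))) \<and>
     (\<forall>A B f. finite A \<and> A \<subseteq> verts D \<and> finite B \<and> B \<subseteq> verts D \<and>
        digraph_iso (induced_subgraph D A) (induced_subgraph D B) f \<longrightarrow>
        (\<exists>g. digraph_iso D D g \<and> (\<forall>x\<in>A. g x = f x)))"

text \<open>
  Maps act on the right: in a product the left factor is applied first. Endomorphisms are
  extensional so that equality of elements is equality of maps on the vertex set.
\<close>

definition End :: "'a digraph \<Rightarrow> ('a \<Rightarrow> 'a) monoid" where
  "End D =
     \<lparr>carrier = {f \<in> extensional (verts D). digraph_hom D D f},
      mult = (\<lambda>f g. compose (verts D) g f),
      one = (\<lambda>x\<in>verts D. x)\<rparr>"

definition green_L :: "('m, 'r) monoid_scheme \<Rightarrow> 'm rel" where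
  "green_L M = {(f, g). f \<in> carrier M \<and> g \<in> carrier M \<and>
     (\<lambda>h. h \<otimes>\<^bsub>M\<^esub> f) ` carrier M = (\<lambda>h. h \<otimes>\<^bsub>M\<^esub> g) ` carrier M}"

definition green_R :: "('m, 'r) monoid_scheme \<Rightarrow> 'm rel" where
  "green_R M = {(f, g). f \<in> carrier M \<and> g \<in> carrier M \<and>
     (\<lambda>h. f \<otimes>\<^bsub>M\<^esub> h) ` carrier M = (\<lambda>h. g \<otimes>\<^bsub>M\<^esub> h) ` carrier M}"

definition green_D :: "('m, 'r) monoid_scheme \<Rightarrow> 'm rel" where
  "green_D M = green_L M O green_R M"

definition regular_element :: "('m, 'r) monoid_scheme \<Rightarrow> 'm \<Rightarrow> bool" where
  "regular_element M f \<longleftrightarrow>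
     f \<in> carrier M \<and> (\<exists>g\<in>carrier M. f \<otimes>\<^bsub>M\<^esub> g \<otimes>\<^bsub>M\<^esub> f = f)"

end

theory Submission imports Defs begin

text \<open>
  Every countable digraph \<open>G\<close> embeds into \<open>D\<close> so that each vertex outside the image has only
  finitely many neighbours in the image. As \<open>D\<close> is algebraically closed, every homomorphism
  \<open>G \<rightarrow> D\<close> then extends along this embedding to an endomorphism of \<open>D\<close>.

  Let \<open>q : D \<rightarrow> \<Gamma>\<close> be a bijective homomorphism, obtained by back-and-forth, and embed as above the
  graph \<open>\<Gamma> \<times> {0,1}\<close> in which every vertex of \<open>\<Gamma>\<close> is doubled into two non-adjacent twins. Each
  choice of one twin per vertex gives an induced copy of \<open>\<Gamma>\<close>; following \<open>q\<close> by these copies yields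
  endomorphisms of \<open>D\<close> that are pairwise \<open>\<R>\<close>-related, but not \<open>\<L>\<close>-related because their images
  differ. A regular injective endomorphism is an embedding, so if one of them were regular, then
  \<open>\<Gamma>\<close> would be isomorphic to \<open>D\<close>.

  Precomposing an injective endomorphism \<open>f\<close> with split surjections of \<open>D\<close> onto \<open>D\<close> stays in the
  \<open>\<L>\<close>-class of \<open>f\<close>, while surjections with different kernels lead to different \<open>\<R>\<close>-classes. The
  surjections extend retractions onto \<open>D\<close> of the disjoint union of \<open>D\<close> with infinitely many
  isolated vertices.
\<close>

section \<open>Homomorphisms and embeddings\<close>

definition adjacent :: "'a digraph \<Rightarrow> 'a \<Rightarrow> 'a \<Rightarrow> bool" where
  "adjacent G u v \<longleftrightarrow> (u, v) \<in> edges G \<or> (v, u) \<in> edges G"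

definition digraph_embedding :: "'a digraph \<Rightarrow> 'b digraph \<Rightarrow> ('a \<Rightarrow> 'b) \<Rightarrow> bool" where
  "digraph_embedding G H e \<longleftrightarrow>
     e \<in> verts G \<rightarrow> verts H \<and> inj_on e (verts G) \<and>
     (\<forall>u\<in>verts G. \<forall>v\<in>verts G. (u, v) \<in> edges G \<longleftrightarrow> (e u, e v) \<in> edges H)"

lemma digraph_edgeD:
  assumes "digraph G" "(u, v) \<in> edges G"
  shows "u \<in> verts G" "v \<in> verts G" "u \<noteq> v"
  using assms by (auto simp: digraph_def irrefl_def)

lemma digraph_homD:
  assumes "digraph_hom G H f"
  shows "u \<in> verts G \<Longrightarrow> f u \<in> verts H" "(u, v) \<in> edges G \<Longrightarrow> (f u, f v) \<in> edges H"
  using assms by (auto simp: digraph_hom_def)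

lemma digraph_embeddingD:
  assumes "digraph_embedding G H e" "u \<in> verts G" "v \<in> verts G"
  shows "e u \<in> verts H" "e u = e v \<longleftrightarrow> u = v" "(e u, e v) \<in> edges H \<longleftrightarrow> (u, v) \<in> edges G"
  using assms by (auto simp: digraph_embedding_def inj_on_eq_iff)

lemma digraph_embedding_imp_hom:
  assumes "digraph G" "digraph_embedding G H e"
  shows "digraph_hom G H e"
  using assms(2) digraph_edgeD[OF assms(1)] unfolding digraph_hom_def digraph_embedding_def by blast

lemma digraph_hom_comp:
  assumes "digraph_hom G H f" "digraph_hom H K g"
  shows "digraph_hom G K (g \<circ> f)"
  using assms by (auto simp: digraph_hom_def)

lemma digraph_embedding_comp:
  assumes "digraph_embedding G H f" "digraph_embedding H K g"
  shows "digraph_embedding G K (g \<circ> f)"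
  using assms by (auto simp: digraph_embedding_def Pi_iff inj_on_def)

lemma digraph_embedding_induced_subgraph:
  assumes "digraph_embedding G H e" "U \<subseteq> verts G"
  shows "digraph_embedding (induced_subgraph G U) H e"
  using assms by (auto simp: digraph_embedding_def induced_subgraph_def inj_on_subset subset_iff)

lemma digraph_iso_imp_embedding: "digraph_iso G H f \<Longrightarrow> digraph_embedding G H f"
  by (auto simp: digraph_iso_def digraph_embedding_def bij_betw_def)

lemma digraph_embedding_onto_image:
  assumes "digraph_embedding G H e"
  shows "digraph_iso G (induced_subgraph H (e ` verts G)) e"
  using assms by (auto simp: digraph_iso_def digraph_embedding_def induced_subgraph_def bij_betw_def)

lemma digraph_embedding_if_iso_induced:
  assumes "digraph_iso G (induced_subgraph H U) e" "U \<subseteq> verts H"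
  shows "digraph_embedding G H e"
  using assms by (auto simp: digraph_iso_def digraph_embedding_def induced_subgraph_def bij_betw_def)

lemma digraph_iso_comp:
  assumes "digraph_iso G H f" "digraph_iso H K g"
  shows "digraph_iso G K (g \<circ> f)"
  using assms by (auto simp: digraph_iso_def bij_betw_apply intro: bij_betw_trans)

lemma digraph_iso_inv_into:
  assumes f: "digraph_iso G H f"
  shows "digraph_iso H G (inv_into (verts G) f)"
proof -
  have bij: "bij_betw f (verts G) (verts H)"
    using f by (simp add: digraph_iso_def)
  have "inv_into (verts G) f y \<in> verts G \<and> f (inv_into (verts G) f y) = y" if "y \<in> verts H" for y
    using bij that by (metis bij_betw_def f_inv_into_f inv_into_into)
  then show ?thesis
    using f by (simp add: digraph_iso_def bij_betw_inv_into)
qed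

lemma isomorphic_sym: "isomorphic G H \<Longrightarrow> isomorphic H G"
  unfolding isomorphic_def by (blast dest: digraph_iso_inv_into)

lemma isomorphic_trans: "isomorphic G H \<Longrightarrow> isomorphic H K \<Longrightarrow> isomorphic G K"
  unfolding isomorphic_def by (blast dest: digraph_iso_comp)

lemma digraph_embedding_imp_isomorphic_image:
  "digraph_embedding G H e \<Longrightarrow> isomorphic G (induced_subgraph H (e ` verts G))"
  unfolding isomorphic_def by (blast dest: digraph_embedding_onto_image)

lemma algebraically_closed_infinite:
  assumes "digraph G" "algebraically_closed G"
  shows "infinite (verts G)"
proof
  assume "finite (verts G)"
  then obtain v where "v \<in> verts G" "(v, v) \<in> edges G"
    using assms(2) unfolding algebraically_closed_def by blast
  then show False
    using digraph_edgeD(3)[OF assms(1)] by blast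
qed

section \<open>The extension property of the universal digraph\<close>

lemma universal_digraph_embeds_finite:
  fixes G :: "'b digraph"
  assumes "universal_digraph D" "digraph G" "finite (verts G)"
  obtains e where "digraph_embedding G D e"
proof -
  obtain c :: "'b \<Rightarrow> nat" where inj: "inj_on c (verts G)"
    using finite_imp_inj_to_nat_seg[OF assms(3)] by metis
  define N where "N = (c ` verts G, map_prod c c ` edges G)"
  have "(c u, c v) \<in> edges N \<longleftrightarrow> (u, v) \<in> edges G" if "u \<in> verts G" "v \<in> verts G" for u v
    using inj_on_image_mem_iff[OF map_prod_inj_on[OF inj inj], of "(u, v)" "edges G"] that assms(2)
    by (simp add: N_def digraph_def)
  then have "digraph_iso G N c"
    using inj by (simp add: digraph_iso_def N_def bij_betw_def)
  moreover have "digraph N"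
    using digraph_edgeD[OF assms(2)] inj_onD[OF inj]
    unfolding digraph_def irrefl_def N_def by fastforce
  then obtain U p where "U \<subseteq> verts D" "digraph_iso N (induced_subgraph D U) p"
    using assms(1,3) unfolding universal_digraph_def isomorphic_def N_def
    by (metis finite_imageI fst_conv)
  ultimately show ?thesis
    using that digraph_embedding_if_iso_induced digraph_iso_comp by metis
qed

lemma universal_digraph_extends_embedding:
  assumes D: "universal_digraph D" and G: "digraph G" "finite (verts G)"
    and A: "A \<subseteq> verts G" and p: "digraph_embedding (induced_subgraph G A) D p"
  obtains e where "digraph_embedding G D e" "\<And>x. x \<in> A \<Longrightarrow> e x = p x"
proof -
  obtain k where k: "digraph_embedding G D k"
    by (rule universal_digraph_embeds_finite[OF D G])
  have verts: "verts (induced_subgraph G A) = A"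
    by (simp add: induced_subgraph_def)
  have kA: "digraph_embedding (induced_subgraph G A) D k"
    by (rule digraph_embedding_induced_subgraph[OF k A])
  have iso: "digraph_iso (induced_subgraph D (k ` A)) (induced_subgraph D (p ` A)) (p \<circ> inv_into A k)"
    using digraph_iso_comp[OF digraph_iso_inv_into digraph_embedding_onto_image[OF p]]
      digraph_embedding_onto_image[OF kA] by (simp add: verts)
  have "finite A" "k ` A \<subseteq> verts D" "p ` A \<subseteq> verts D" "inj_on k A"
    using finite_subset[OF A G(2)] kA p by (auto simp: digraph_embedding_def verts)
  then obtain g where g: "digraph_iso D D g" "\<forall>x\<in>k ` A. g x = (p \<circ> inv_into A k) x"
    using D iso unfolding universal_digraph_def by (metis finite_imageI)
  show ?thesis
  proof
    show "digraph_embedding G D (g \<circ> k)"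
      using digraph_embedding_comp[OF k digraph_iso_imp_embedding[OF g(1)]] .
    show "(g \<circ> k) x = p x" if "x \<in> A" for x
      using g(2) that \<open>inj_on k A\<close> by simp
  qed
qed

locale generic_digraph =
  fixes D :: "'a digraph"
  assumes digraph: "digraph D"
    and countable_verts: "countable (verts D)"
    and extension: "\<And>A I J. finite A \<Longrightarrow> A \<subseteq> verts D \<Longrightarrow>
      \<exists>v\<in>verts D - A. \<forall>u\<in>A. ((u, v) \<in> edges D \<longleftrightarrow> u \<in> I) \<and> ((v, u) \<in> edges D \<longleftrightarrow> u \<in> J)"
begin

lemma ex_vertex_joined_to:
  assumes "finite A" "A \<subseteq> verts D"
  obtains v where "v \<in> verts D" "v \<notin> A"
    "\<forall>u\<in>A. (u, v) \<in> edges D \<longleftrightarrow> u \<in> I" "\<forall>u\<in>A. (v, u) \<in> edges D \<longleftrightarrow> u \<in> J"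
  using extension[OF assms, of I J] by blast

lemma algebraically_closed: "algebraically_closed D"
  unfolding algebraically_closed_def
proof (intro allI impI, elim conjE)
  fix A assume "finite A" "A \<subseteq> verts D"
  then obtain v where "v \<in> verts D" "v \<notin> A"
    "\<forall>u\<in>A. (u, v) \<in> edges D \<longleftrightarrow> u \<in> A" "\<forall>u\<in>A. (v, u) \<in> edges D \<longleftrightarrow> u \<in> A"
    by (rule ex_vertex_joined_to)
  then show "\<exists>v\<in>verts D. \<forall>u\<in>A. (u, v) \<in> edges D \<and> (v, u) \<in> edges D"
    by blast
qed

lemma ex_edge: obtains a b where "(a, b) \<in> edges D"
proof -
  obtain a where a: "a \<in> verts D"
    using algebraically_closed unfolding algebraically_closed_def by blast
  then show ?thesis
    using algebraically_closed that unfolding algebraically_closed_def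
    by (metis empty_subsetI finite.simps insert_subset singletonI)
qed

end

lemma universal_digraph_imp_generic:
  fixes D :: "'a digraph"
  assumes D: "universal_digraph D"
  shows "generic_digraph D"
proof
  show digraph: "digraph D" and "countable (verts D)"
    using D by (auto simp: universal_digraph_def)
  fix A I J :: "'a set"
  assume A: "finite A" "A \<subseteq> verts D"
  define G :: "'a option digraph" where
    "G = (insert None (Some ` A),
      map_prod Some Some ` (edges D \<inter> A \<times> A) \<union>
      {(Some u, None) |u. u \<in> A \<inter> I} \<union> {(None, Some u) |u. u \<in> A \<inter> J})"
  have G: "digraph G" "finite (verts G)" "Some ` A \<subseteq> verts G"
    using A by (auto simp: G_def digraph_def irrefl_def dest: digraph_edgeD(3)[OF digraph])
  have "digraph_embedding (induced_subgraph G (Some ` A)) D the"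
    using A(2) by (auto simp: digraph_embedding_def induced_subgraph_def G_def inj_on_def)
  then obtain e where e: "digraph_embedding G D e" "\<And>x. x \<in> Some ` A \<Longrightarrow> e x = the x"
    using universal_digraph_extends_embedding[OF D G] by blast
  have e_Some: "e (Some u) = u" if "u \<in> A" for u
    using e(2) that by simp
  have None: "None \<in> verts G" and Some: "\<And>u. u \<in> A \<Longrightarrow> Some u \<in> verts G"
    by (auto simp: G_def)
  have "((u, e None) \<in> edges D \<longleftrightarrow> u \<in> I) \<and> ((e None, u) \<in> edges D \<longleftrightarrow> u \<in> J)" if u: "u \<in> A" for u
    using digraph_embeddingD(3)[OF e(1) Some[OF u] None]
      digraph_embeddingD(3)[OF e(1) None Some[OF u]] u
    by (auto simp: e_Some G_def)
  moreover have "e None \<notin> A"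
    using digraph_embeddingD(2)[OF e(1) Some None] e_Some by blast
  moreover have "e None \<in> verts D"
    using e(1) by (auto simp: digraph_embedding_def G_def)
  ultimately show "\<exists>v\<in>verts D - A. \<forall>u\<in>A.
      ((u, v) \<in> edges D \<longleftrightarrow> u \<in> I) \<and> ((v, u) \<in> edges D \<longleftrightarrow> u \<in> J)"
    by blast
qed

section \<open>Meeting countably many requirements\<close>

lemma ex_pairwise_set_meeting_requirements:
  fixes meets :: "'i \<Rightarrow> 'p \<Rightarrow> bool"
  assumes "countable I"
    and step: "\<And>P i. finite P \<Longrightarrow> P \<subseteq> S \<Longrightarrow> pairwise r P \<Longrightarrow> i \<in> I \<Longrightarrow>
      \<exists>p\<in>S. meets i p \<and> pairwise r (insert p P)"
  obtains T where "T \<subseteq> S" "pairwise r T" "\<And>i. i \<in> I \<Longrightarrow> \<exists>p\<in>T. meets i p"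
proof (cases "I = {}")
  case True
  then show ?thesis
    using that[of "{}"] by simp
next
  case False
  let ?ok = "\<lambda>P. finite P \<and> P \<subseteq> S \<and> pairwise r P"
  have "\<exists>P. \<forall>n. ?ok (P n) \<and> P n \<subseteq> P (Suc n) \<and> (\<exists>p\<in>P (Suc n). meets (from_nat_into I n) p)"
  proof (rule dependent_nat_choice)
    show "\<exists>P. ?ok P"
      by (rule exI[of _ "{}"]) simp
    fix P n assume P: "?ok P"
    then obtain p where "p \<in> S" "meets (from_nat_into I n) p" "pairwise r (insert p P)"
      using step from_nat_into[OF False] by metis
    then show "\<exists>P'. ?ok P' \<and> P \<subseteq> P' \<and> (\<exists>p\<in>P'. meets (from_nat_into I n) p)"
      using P by (intro exI[of _ "insert p P"]) auto
  qed
  then obtain P where P: "\<And>n. ?ok (P n)" "\<And>n. P n \<subseteq> P (Suc n)"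
    "\<And>n. \<exists>p\<in>P (Suc n). meets (from_nat_into I n) p"
    by blast
  have "P m \<subseteq> P n" if "m \<le> n" for m n
    by (rule lift_Suc_mono_le[of P, OF P(2) that])
  then have "chain\<^sub>\<subseteq> (range P)"
    unfolding chain_subset_def by (metis nat_le_linear rangeE)
  then have "pairwise r (\<Union>n. P n)"
    using P(1) pairwise_chain_Union[of "range P" r] by blast
  then show ?thesis
    using that[of "\<Union>n. P n"] P(1,3) from_nat_into_to_nat_on[OF \<open>countable I\<close>]
    by (metis UN_iff UN_least UNIV_I)
qed

lemma ex_bij_betw_selecting_from_relation:
  assumes "T \<subseteq> A \<times> B" "A \<subseteq> Domain T" "B \<subseteq> Range T" "single_valued T" "single_valued (T\<inverse>)"
  obtains q where "bij_betw q A B" "\<And>x. x \<in> A \<Longrightarrow> (x, q x) \<in> T"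
proof -
  have "\<exists>y. (x, y) \<in> T" if "x \<in> A" for x
    using assms(2) that by blast
  then obtain q where q: "\<And>x. x \<in> A \<Longrightarrow> (x, q x) \<in> T"
    by metis
  have "inj_on q A"
    using q assms(5) by (metis converseI inj_onI single_valuedD)
  moreover have "q ` A = B"
  proof (intro equalityI subsetI)
    fix y assume "y \<in> B"
    then obtain x where "(x, y) \<in> T"
      using assms(3) by blast
    then have "x \<in> A" "q x = y"
      using assms(1) q single_valuedD[OF assms(4)] by blast+
    then show "y \<in> q ` A"
      by blast
  qed (use q assms(1) in blast)
  ultimately show ?thesis
    using that q by (simp add: bij_betw_def)
qed

section \<open>Extending homomorphisms along finitely attached embeddings\<close>

definition finitely_attached :: "'a digraph \<Rightarrow> 'b digraph \<Rightarrow> ('a \<Rightarrow> 'b) \<Rightarrow> bool" where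
  "finitely_attached G D e \<longleftrightarrow>
     (\<forall>d\<in>verts D - e ` verts G. finite {x \<in> verts G. adjacent D (e x) d})"

lemma algebraically_closed_ex_joined_family:
  assumes H: "algebraically_closed H" and W: "countable W"
    and F: "\<And>d. d \<in> W \<Longrightarrow> finite (F d)" "\<And>d. d \<in> W \<Longrightarrow> F d \<subseteq> verts H"
  obtains f where "\<And>d. d \<in> W \<Longrightarrow> f d \<in> verts H"
    "\<And>d z. d \<in> W \<Longrightarrow> z \<in> F d \<Longrightarrow> (z, f d) \<in> edges H \<and> (f d, z) \<in> edges H"
    "\<And>d d'. d \<in> W \<Longrightarrow> d' \<in> W \<Longrightarrow> d \<noteq> d' \<Longrightarrow> (f d, f d') \<in> edges H"
proof -
  define S where "S = {(d, y). d \<in> W \<and> y \<in> verts H \<and> (\<forall>z\<in>F d. (z, y) \<in> edges H \<and> (y, z) \<in> edges H)}"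
  let ?r = "\<lambda>t t'. (snd t, snd t') \<in> edges H"
  have "\<exists>t\<in>S. fst t = d \<and> pairwise ?r (insert t P)"
    if P: "finite P" "P \<subseteq> S" "pairwise ?r P" and d: "d \<in> W" for P d
  proof -
    have "finite (F d \<union> snd ` P)" "F d \<union> snd ` P \<subseteq> verts H"
      using P(1,2) d F by (auto simp: S_def)
    then obtain y where "y \<in> verts H" "\<forall>z\<in>F d \<union> snd ` P. (z, y) \<in> edges H \<and> (y, z) \<in> edges H"
      using H unfolding algebraically_closed_def by meson
    then show ?thesis
      using P(3) d by (intro bexI[of _ "(d, y)"]) (auto simp: pairwise_insert S_def)
  qed
  then obtain T where T: "T \<subseteq> S" "pairwise ?r T" and meets: "\<And>d. d \<in> W \<Longrightarrow> \<exists>t\<in>T. fst t = d"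
    using ex_pairwise_set_meeting_requirements[of W S ?r "\<lambda>d t. fst t = d"] W by metis
  have "\<exists>y. (d, y) \<in> T" if "d \<in> W" for d
    using meets[OF that] by force
  then obtain f where f: "\<And>d. d \<in> W \<Longrightarrow> (d, f d) \<in> T"
    by metis
  show ?thesis
  proof
    show "f d \<in> verts H" "z \<in> F d \<Longrightarrow> (z, f d) \<in> edges H \<and> (f d, z) \<in> edges H" if "d \<in> W" for d z
      using subsetD[OF T(1) f[OF that]] by (auto simp: S_def)
    show "(f d, f d') \<in> edges H" if "d \<in> W" "d' \<in> W" "d \<noteq> d'" for d d'
      using pairwiseD(1)[OF T(2) f[OF that(1)] f[OF that(2)]] that(3) by simp
  qed
qed

lemma ex_hom_extending_along_embedding:
  assumes D: "digraph D" and e: "digraph_embedding G D e" and p: "digraph_hom G H p"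
    and f: "\<And>d. d \<in> verts D - e ` verts G \<Longrightarrow> f d \<in> verts H"
      "\<And>d d'. d \<in> verts D - e ` verts G \<Longrightarrow> d' \<in> verts D - e ` verts G \<Longrightarrow>
         (d, d') \<in> edges D \<Longrightarrow> (f d, f d') \<in> edges H"
      "\<And>x d. x \<in> verts G \<Longrightarrow> d \<in> verts D - e ` verts G \<Longrightarrow>
         adjacent D (e x) d \<Longrightarrow> (p x, f d) \<in> edges H \<and> (f d, p x) \<in> edges H"
  obtains h where "digraph_hom D H h" "\<And>x. x \<in> verts G \<Longrightarrow> h (e x) = p x"
proof -
  define h where "h d = (if d \<in> e ` verts G then p (inv_into (verts G) e d) else f d)" for d
  have h_image: "h (e x) = p x" if "x \<in> verts G" for x
    using e that by (simp add: h_def digraph_embedding_def)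
  have h_outside: "h d = f d" if "d \<in> verts D - e ` verts G" for d
    using that by (simp add: h_def)
  have "(h u, h v) \<in> edges H" if uv: "(u, v) \<in> edges D" for u v
  proof -
    consider (outside) "u \<in> verts D - e ` verts G" "v \<in> verts D - e ` verts G"
      | (leaving) x where "x \<in> verts G" "u = e x" "v \<in> verts D - e ` verts G"
      | (entering) y where "y \<in> verts G" "v = e y" "u \<in> verts D - e ` verts G"
      | (inside) x y where "x \<in> verts G" "y \<in> verts G" "u = e x" "v = e y"
      using digraph_edgeD[OF D uv] by auto
    then show ?thesis
    proof cases
      case outside
      then show ?thesis
        using f(2) uv by (simp add: h_outside)
    next
      case leaving
      then show ?thesis
        using f(3) uv by (simp add: h_image h_outside adjacent_def)
    next
      case entering
      then show ?thesis
        using f(3) uv by (simp add: h_image h_outside adjacent_def)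
    next
      case inside
      then show ?thesis
        using digraph_homD(2)[OF p] digraph_embeddingD(3)[OF e] uv by (simp add: h_image)
    qed
  qed
  moreover have "h d \<in> verts H" if "d \<in> verts D" for d
    using that f(1) digraph_homD(1)[OF p] by (cases "d \<in> e ` verts G") (auto simp: h_image h_outside)
  ultimately have "digraph_hom D H h"
    by (auto simp: digraph_hom_def)
  then show ?thesis
    using that h_image by blast
qed

lemma hom_extends_along_finitely_attached_embedding:
  assumes D: "digraph D" "countable (verts D)" and H: "algebraically_closed H"
    and e: "digraph_embedding G D e" "finitely_attached G D e" and p: "digraph_hom G H p"
  obtains h where "digraph_hom D H h" "\<And>x. x \<in> verts G \<Longrightarrow> h (e x) = p x"
proof -
  let ?W = "verts D - e ` verts G" and ?F = "\<lambda>d. p ` {x \<in> verts G. adjacent D (e x) d}"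
  have "countable ?W" "\<And>d. d \<in> ?W \<Longrightarrow> finite (?F d)" "\<And>d. d \<in> ?W \<Longrightarrow> ?F d \<subseteq> verts H"
    using D(2) e(2) digraph_homD(1)[OF p] by (auto simp: finitely_attached_def)
  then obtain f where f: "\<And>d. d \<in> ?W \<Longrightarrow> f d \<in> verts H"
    "\<And>d z. d \<in> ?W \<Longrightarrow> z \<in> ?F d \<Longrightarrow> (z, f d) \<in> edges H \<and> (f d, z) \<in> edges H"
    "\<And>d d'. d \<in> ?W \<Longrightarrow> d' \<in> ?W \<Longrightarrow> d \<noteq> d' \<Longrightarrow> (f d, f d') \<in> edges H"
    using algebraically_closed_ex_joined_family[OF H, of ?W ?F] by blast
  show ?thesis
  proof (rule ex_hom_extending_along_embedding[OF D(1) e(1) p, of f])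
    show "(f d, f d') \<in> edges H" if "d \<in> ?W" "d' \<in> ?W" "(d, d') \<in> edges D" for d d'
      using f(3) that digraph_edgeD(3)[OF D(1)] by blast
    show "(p x, f d) \<in> edges H \<and> (f d, p x) \<in> edges H"
      if "x \<in> verts G" "d \<in> ?W" "adjacent D (e x) d" for x d
      using f(2)[OF that(2)] that(1,3) by blast
  qed (use f(1) that in blast)+
qed

text \<open>
  Finite approximations to a finitely attached embedding \<open>e\<close>: \<open>Send x y\<close> demands that \<open>e x = y\<close>,
  and \<open>Confine d N\<close> that \<open>d\<close> is outside the image and only the vertices of \<open>N\<close> have an image
  adjacent to \<open>d\<close>.
\<close>

datatype ('a, 'b) demand = Send (source: 'a) (target: 'b) | Confine (target: 'b) "'a set"

fun compatible :: "'a digraph \<Rightarrow> 'b digraph \<Rightarrow> ('a, 'b) demand \<Rightarrow> ('a, 'b) demand \<Rightarrow> bool" where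
  "compatible G D (Send x y) (Send x' y') \<longleftrightarrow>
     x \<noteq> x' \<and> y \<noteq> y' \<and> ((x, x') \<in> edges G \<longleftrightarrow> (y, y') \<in> edges D)"
| "compatible G D (Send x y) (Confine d N) \<longleftrightarrow> y \<noteq> d \<and> (adjacent D y d \<longrightarrow> x \<in> N)"
| "compatible G D (Confine d N) t \<longleftrightarrow> True"

definition demands :: "'a digraph \<Rightarrow> 'b digraph \<Rightarrow> ('a, 'b) demand set" where
  "demands G D = {Send x y |x y. x \<in> verts G \<and> y \<in> verts D} \<union> {Confine d N |d N. d \<in> verts D \<and> finite N}"

lemma pairwise_compatible_insert_Send:
  assumes P: "pairwise (compatible G D) P" and x: "\<And>y. Send x y \<notin> P" and v: "v \<notin> target ` P"
    and joined: "\<forall>u\<in>target ` P. (u, v) \<in> edges D \<longleftrightarrow> u \<in> {y. \<exists>x'. Send x' y \<in> P \<and> (x', x) \<in> edges G}"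
      "\<forall>u\<in>target ` P. (v, u) \<in> edges D \<longleftrightarrow> u \<in> {y. \<exists>x'. Send x' y \<in> P \<and> (x, x') \<in> edges G}"
  shows "pairwise (compatible G D) (insert (Send x v) P)"
proof -
  have "compatible G D (Send x v) t \<and> compatible G D t (Send x v)" if t: "t \<in> P" for t
  proof (cases t)
    case (Send x' y)
    have y: "y \<in> target ` P"
      using t Send by force
    have "x'' = x'" if "Send x'' y \<in> P" for x''
      using pairwiseD(1)[OF P that, of "Send x' y"] t Send by auto
    then have "(y, v) \<in> edges D \<longleftrightarrow> (x', x) \<in> edges G" "(v, y) \<in> edges D \<longleftrightarrow> (x, x') \<in> edges G"
      using joined y t Send by blast+
    moreover have "x \<noteq> x'" "v \<noteq> y"
      using x v y t Send by auto
    ultimately show ?thesis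
      using Send by simp
  next
    case (Confine d N)
    have d: "d \<in> target ` P"
      using t Confine by force
    have "Send x' d \<notin> P" for x'
      using pairwiseD(1)[OF P, of "Send x' d" t] t Confine by auto
    then show ?thesis
      using v joined d Confine by (auto simp: adjacent_def)
  qed
  then show ?thesis
    using P by (simp add: pairwise_insert)
qed

text \<open>Confinement demands have no \<^const>\<open>source\<close>; their unspecified values in \<open>source ` P\<close> do no harm.\<close>

lemma pairwise_compatible_insert_Confine:
  assumes "pairwise (compatible G D) P" "\<And>x. Send x d \<notin> P"
  shows "pairwise (compatible G D) (insert (Confine d (source ` P)) P)"
proof -
  have "compatible G D t (Confine d (source ` P))" if "t \<in> P" for t
    using that assms(2) by (cases t) force+
  then show ?thesis
    using assms(1) by (simp add: pairwise_insert)
qed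

lemma finitely_attached_embedding_if_compatible:
  assumes G: "digraph G" and D: "digraph D" and T: "T \<subseteq> demands G D" "pairwise (compatible G D) T"
    and sends: "\<And>x. x \<in> verts G \<Longrightarrow> Send x (e x) \<in> T"
    and answered: "\<And>d. d \<in> verts D \<Longrightarrow> (\<exists>x. Send x d \<in> T) \<or> (\<exists>N. Confine d N \<in> T)"
  shows "digraph_embedding G D e" "finitely_attached G D e"
proof -
  have compat: "x \<noteq> x' \<Longrightarrow> compatible G D (Send x (e x)) (Send x' (e x'))"
    if "x \<in> verts G" "x' \<in> verts G" for x x'
    using pairwiseD(1)[OF T(2) sends[OF that(1)] sends[OF that(2)]] by simp
  have "e x \<in> verts D" if "x \<in> verts G" for x
    using subsetD[OF T(1) sends[OF that]] by (simp add: demands_def)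
  moreover have "inj_on e (verts G)"
    using compat by (fastforce simp: inj_on_def)
  moreover have "(u, v) \<in> edges G \<longleftrightarrow> (e u, e v) \<in> edges D" if "u \<in> verts G" "v \<in> verts G" for u v
    using compat[OF that] digraph_edgeD(3)[OF G] digraph_edgeD(3)[OF D] by (cases "u = v") auto
  ultimately show "digraph_embedding G D e"
    by (simp add: digraph_embedding_def)
  show "finitely_attached G D e"
    unfolding finitely_attached_def
  proof
    fix d assume d: "d \<in> verts D - e ` verts G"
    have "Send x d \<notin> T" for x
    proof
      assume x: "Send x d \<in> T"
      then have "x \<in> verts G"
        using T(1) by (auto simp: demands_def)
      then show False
        using pairwiseD(1)[OF T(2) x sends[of x]] d by auto
    qed
    then obtain N where N: "Confine d N \<in> T"
      using answered d by blast
    then have "finite N"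
      using T(1) by (auto simp: demands_def)
    moreover have "{x \<in> verts G. adjacent D (e x) d} \<subseteq> N"
      using pairwiseD(1)[OF T(2) sends N] by auto
    ultimately show "finite {x \<in> verts G. adjacent D (e x) d}"
      by (rule rev_finite_subset)
  qed
qed

context generic_digraph
begin

lemma ex_compatible_Send:
  assumes P: "finite P" "P \<subseteq> demands G D" "pairwise (compatible G D) P"
    and x: "x \<in> verts G"
  obtains y where "y \<in> verts D" "pairwise (compatible G D) (insert (Send x y) P)"
proof (cases "\<exists>y. Send x y \<in> P")
  case True
  then obtain y where y: "Send x y \<in> P"
    by blast
  then have "y \<in> verts D"
    using P(2) by (auto simp: demands_def)
  then show ?thesis
    using that P(3) y by (simp add: insert_absorb)
next
  case False
  have "finite (target ` P)" "target ` P \<subseteq> verts D"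
    using P(1,2) by (auto simp: demands_def)
  then obtain v where v: "v \<in> verts D" "v \<notin> target ` P"
    "\<forall>u\<in>target ` P. (u, v) \<in> edges D \<longleftrightarrow> u \<in> {y. \<exists>x'. Send x' y \<in> P \<and> (x', x) \<in> edges G}"
    "\<forall>u\<in>target ` P. (v, u) \<in> edges D \<longleftrightarrow> u \<in> {y. \<exists>x'. Send x' y \<in> P \<and> (x, x') \<in> edges G}"
    by (rule ex_vertex_joined_to)
  then show ?thesis
    using that pairwise_compatible_insert_Send[OF P(3)] False by blast
qed

lemma ex_finitely_attached_embedding:
  assumes G: "digraph G" "countable (verts G)"
  obtains e where "digraph_embedding G D e" "finitely_attached G D e"
proof -
  define meets where "meets i t \<longleftrightarrow> (case i of Inl x \<Rightarrow> \<exists>y. t = Send x y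
      | Inr d \<Rightarrow> (\<exists>x. t = Send x d) \<or> (\<exists>N. t = Confine d N))" for i and t :: "('b, 'a) demand"
  have "\<exists>t\<in>demands G D. meets i t \<and> pairwise (compatible G D) (insert t P)"
    if P: "finite P" "P \<subseteq> demands G D" "pairwise (compatible G D) P"
      and i: "i \<in> verts G <+> verts D" for P i
  proof (cases i)
    case (Inl x)
    with i obtain y where "y \<in> verts D" "pairwise (compatible G D) (insert (Send x y) P)"
      using ex_compatible_Send[OF P] by blast
    then show ?thesis
      using i Inl by (intro bexI[of _ "Send x y"]) (auto simp: meets_def demands_def)
  next
    case (Inr d)
    show ?thesis
    proof (cases "\<exists>x. Send x d \<in> P")
      case True
      then obtain x where "Send x d \<in> P"
        by blast
      then show ?thesis
        using P(2,3) Inr by (intro bexI[of _ "Send x d"]) (auto simp: meets_def insert_absorb)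
    next
      case False
      then show ?thesis
        using pairwise_compatible_insert_Confine[OF P(3)] P(1) i Inr
        by (intro bexI[of _ "Confine d (source ` P)"]) (auto simp: meets_def demands_def)
    qed
  qed
  then obtain T where T: "T \<subseteq> demands G D" "pairwise (compatible G D) T"
    and meets: "\<And>i. i \<in> verts G <+> verts D \<Longrightarrow> \<exists>t\<in>T. meets i t"
    using ex_pairwise_set_meeting_requirements[of
        "verts G <+> verts D" "demands G D" "compatible G D" meets]
      G(2) countable_verts by (metis countable_Plus)
  have "\<exists>y. Send x y \<in> T" if "x \<in> verts G" for x
    using meets[OF InlI[OF that]] by (auto simp: meets_def)
  then obtain e where "\<And>x. x \<in> verts G \<Longrightarrow> Send x (e x) \<in> T"
    by metis
  moreover have "(\<exists>x. Send x d \<in> T) \<or> (\<exists>N. Confine d N \<in> T)" if "d \<in> verts D" for d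
    using meets[OF InrI[OF that]] by (auto simp: meets_def)
  ultimately show ?thesis
    using that finitely_attached_embedding_if_compatible[OF G(1) digraph T] by blast
qed

end

section \<open>Bijective homomorphisms by back-and-forth\<close>

definition injective_hom_pair :: "'a digraph \<Rightarrow> 'b digraph \<Rightarrow> 'a \<times> 'b \<Rightarrow> 'a \<times> 'b \<Rightarrow> bool" where
  "injective_hom_pair G H t t' \<longleftrightarrow> fst t \<noteq> fst t' \<and> snd t \<noteq> snd t' \<and>
     ((fst t, fst t') \<in> edges G \<longrightarrow> (snd t, snd t') \<in> edges H)"

context generic_digraph
begin

lemma ex_partial_injective_hom_forth:
  assumes H: "digraph H" "algebraically_closed H"
    and P: "finite P" "P \<subseteq> verts D \<times> verts H" "pairwise (injective_hom_pair D H) P"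
    and x: "x \<in> verts D"
  obtains y where "y \<in> verts H" "pairwise (injective_hom_pair D H) (insert (x, y) P)"
proof (cases "x \<in> Domain P")
  case True
  then obtain y where "(x, y) \<in> P"
    by blast
  then show ?thesis
    using that[of y] P(2,3) by (auto simp: insert_absorb)
next
  case False
  have "finite (snd ` P)" "snd ` P \<subseteq> verts H"
    using P(1,2) by auto
  then obtain y where y: "y \<in> verts H" "\<forall>u\<in>snd ` P. (u, y) \<in> edges H \<and> (y, u) \<in> edges H"
    using H(2) unfolding algebraically_closed_def by meson
  have "injective_hom_pair D H (x, y) t \<and> injective_hom_pair D H t (x, y)" if "t \<in> P" for t
  proof -
    have "fst t \<noteq> x" "(snd t, y) \<in> edges H" "(y, snd t) \<in> edges H"
      using that False y(2) by (auto simp: Domain_fst)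
    then show ?thesis
      using digraph_edgeD(3)[OF H(1)] by (auto simp: injective_hom_pair_def)
  qed
  then show ?thesis
    using that y(1) P(3) by (simp add: pairwise_insert)
qed

lemma ex_partial_injective_hom_back:
  assumes P: "finite P" "P \<subseteq> verts D \<times> verts H" "pairwise (injective_hom_pair D H) P"
    and y: "y \<in> verts H"
  obtains x where "x \<in> verts D" "pairwise (injective_hom_pair D H) (insert (x, y) P)"
proof (cases "y \<in> Range P")
  case True
  then obtain x where "(x, y) \<in> P"
    by blast
  then show ?thesis
    using that[of x] P(2,3) by (auto simp: insert_absorb)
next
  case False
  have "finite (fst ` P)" "fst ` P \<subseteq> verts D"
    using P(1,2) by auto
  then obtain x where x: "x \<in> verts D" "x \<notin> fst ` P"
    "\<forall>u\<in>fst ` P. (u, x) \<in> edges D \<longleftrightarrow> u \<in> {}" "\<forall>u\<in>fst ` P. (x, u) \<in> edges D \<longleftrightarrow> u \<in> {}"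
    by (rule ex_vertex_joined_to)
  have "injective_hom_pair D H (x, y) t \<and> injective_hom_pair D H t (x, y)" if "t \<in> P" for t
  proof -
    have "fst t \<in> fst ` P" "snd t \<noteq> y"
      using that False by (auto simp: Range_snd)
    then show ?thesis
      using x by (auto simp: injective_hom_pair_def)
  qed
  then show ?thesis
    using that x(1) P(3) by (simp add: pairwise_insert)
qed

lemma ex_bijective_hom:
  assumes H: "digraph H" "countable (verts H)" "algebraically_closed H"
  obtains q where "digraph_hom D H q" "bij_betw q (verts D) (verts H)"
proof -
  define meets where "meets i t \<longleftrightarrow> (case i of Inl x \<Rightarrow> fst t = x | Inr y \<Rightarrow> snd t = y)"
    for i and t :: "'a \<times> 'b"
  let ?r = "injective_hom_pair D H"
  have "\<exists>t\<in>verts D \<times> verts H. meets i t \<and> pairwise ?r (insert t P)"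
    if P: "finite P" "P \<subseteq> verts D \<times> verts H" "pairwise ?r P" and i: "i \<in> verts D <+> verts H" for P i
  proof (cases i)
    case (Inl x)
    with i obtain y where "y \<in> verts H" "pairwise ?r (insert (x, y) P)"
      using ex_partial_injective_hom_forth[OF H(1,3) P] by blast
    then show ?thesis
      using i Inl by (intro bexI[of _ "(x, y)"]) (auto simp: meets_def)
  next
    case (Inr y)
    with i obtain x where "x \<in> verts D" "pairwise ?r (insert (x, y) P)"
      using ex_partial_injective_hom_back[OF P] by blast
    then show ?thesis
      using i Inr by (intro bexI[of _ "(x, y)"]) (auto simp: meets_def)
  qed
  then obtain T where T: "T \<subseteq> verts D \<times> verts H" "pairwise ?r T"
    and meets: "\<And>i. i \<in> verts D <+> verts H \<Longrightarrow> \<exists>t\<in>T. meets i t"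
    using ex_pairwise_set_meeting_requirements[of "verts D <+> verts H" "verts D \<times> verts H" ?r meets]
      H(2) countable_verts by (metis countable_Plus)
  have "verts D \<subseteq> Domain T" "verts H \<subseteq> Range T"
    using meets[OF InlI] meets[OF InrI] by (fastforce simp: meets_def)+
  moreover have "single_valued T" "single_valued (T\<inverse>)"
    using pairwiseD(1)[OF T(2)] by (fastforce simp: single_valued_def injective_hom_pair_def)+
  ultimately obtain q where q: "bij_betw q (verts D) (verts H)" "\<And>x. x \<in> verts D \<Longrightarrow> (x, q x) \<in> T"
    using ex_bij_betw_selecting_from_relation[OF T(1)] by metis
  have "(q u, q v) \<in> edges H" if "(u, v) \<in> edges D" for u v
    using pairwiseD(1)[OF T(2) q(2) q(2), of u v] digraph_edgeD[OF digraph that] that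
    by (simp add: injective_hom_pair_def)
  then have "digraph_hom D H q"
    using q(1) by (auto simp: digraph_hom_def bij_betw_def)
  then show ?thesis
    using that q(1) by blast
qed

end

section \<open>Green's relations\<close>

context monoid
begin

lemma left_ideal_subset_iff:
  assumes "a \<in> carrier G" "b \<in> carrier G"
  shows "(\<lambda>h. h \<otimes> a) ` carrier G \<subseteq> (\<lambda>h. h \<otimes> b) ` carrier G \<longleftrightarrow> (\<exists>u\<in>carrier G. a = u \<otimes> b)"
proof
  assume "(\<lambda>h. h \<otimes> a) ` carrier G \<subseteq> (\<lambda>h. h \<otimes> b) ` carrier G"
  moreover have "a \<in> (\<lambda>h. h \<otimes> a) ` carrier G"
    using assms by (intro image_eqI[of _ _ \<one>]) auto
  ultimately show "\<exists>u\<in>carrier G. a = u \<otimes> b"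
    by blast
next
  assume "\<exists>u\<in>carrier G. a = u \<otimes> b"
  then obtain u where "u \<in> carrier G" "a = u \<otimes> b"
    by blast
  then show "(\<lambda>h. h \<otimes> a) ` carrier G \<subseteq> (\<lambda>h. h \<otimes> b) ` carrier G"
    using assms by (auto simp: m_assoc[symmetric])
qed

lemma green_L_iff:
  "(a, b) \<in> green_L G \<longleftrightarrow> a \<in> carrier G \<and> b \<in> carrier G \<and>
     (\<exists>u\<in>carrier G. a = u \<otimes> b) \<and> (\<exists>v\<in>carrier G. b = v \<otimes> a)"
  unfolding green_L_def set_eq_subset using left_ideal_subset_iff by blast

end

definition opposite_monoid :: "('m, 'r) monoid_scheme \<Rightarrow> ('m, 'r) monoid_scheme" where
  "opposite_monoid M = M\<lparr>mult := \<lambda>x y. y \<otimes>\<^bsub>M\<^esub> x\<rparr>"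

lemma green_L_opposite_monoid: "green_L (opposite_monoid M) = green_R M"
  by (simp add: green_L_def green_R_def opposite_monoid_def)

context monoid
begin

lemma monoid_opposite_monoid: "monoid (opposite_monoid G)"
  by unfold_locales (auto simp: opposite_monoid_def m_assoc)

lemma green_R_iff:
  "(a, b) \<in> green_R G \<longleftrightarrow> a \<in> carrier G \<and> b \<in> carrier G \<and>
     (\<exists>u\<in>carrier G. a = b \<otimes> u) \<and> (\<exists>v\<in>carrier G. b = a \<otimes> v)"
  using monoid.green_L_iff[OF monoid_opposite_monoid, of a b]
  by (simp add: green_L_opposite_monoid) (simp add: opposite_monoid_def)

lemma green_R_O_green_L_subset_green_D: "green_R G O green_L G \<subseteq> green_D G"
proof clarify
  fix a b c assume "(a, b) \<in> green_R G" "(b, c) \<in> green_L G"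
  then obtain u v w z where uv: "u \<in> carrier G" "v \<in> carrier G" "a = b \<otimes> u" "b = a \<otimes> v"
    and wz: "w \<in> carrier G" "z \<in> carrier G" "b = w \<otimes> c" "c = z \<otimes> b"
    and carrier: "a \<in> carrier G" "b \<in> carrier G" "c \<in> carrier G"
    unfolding green_L_iff green_R_iff by blast
  have "c \<otimes> u = z \<otimes> a"
    using uv wz carrier by (metis m_assoc)
  moreover have "a = w \<otimes> (c \<otimes> u)"
    using uv wz carrier by (metis m_assoc)
  moreover have "c = c \<otimes> u \<otimes> v"
    using uv wz carrier by (metis m_assoc)
  ultimately have "(a, c \<otimes> u) \<in> green_L G" "(c \<otimes> u, c) \<in> green_R G"
    unfolding green_L_iff green_R_iff using carrier uv wz by (metis m_closed)+
  then show "(a, c) \<in> green_D G"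
    unfolding green_D_def by blast
qed

lemma green_L_mult_split:
  assumes "s \<in> carrier G" "h \<in> carrier G" "f \<in> carrier G" "s \<otimes> h = \<one>"
  shows "(f, h \<otimes> f) \<in> green_L G"
proof -
  have "f = s \<otimes> (h \<otimes> f)"
    using assms by (simp flip: m_assoc)
  then show ?thesis
    unfolding green_L_iff using assms by blast
qed

end

lemma quotient_classes_eqpoll_UNIV:
  fixes F :: "'i \<Rightarrow> 'm"
  assumes A: "A \<lesssim> (UNIV :: 'i set)"
    and F: "\<And>i. F i \<in> A" "\<And>i. (F i, F i) \<in> r" "\<And>i. r `` {F i} \<subseteq> B"
    and inj: "\<And>i j. (F i, F j) \<in> r \<Longrightarrow> i = j"
  shows "{C \<in> A // r. C \<subseteq> B} \<approx> (UNIV :: 'i set)"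
proof (rule lepoll_antisym)
  have "{C \<in> A // r. C \<subseteq> B} \<subseteq> (\<lambda>x. r `` {x}) ` A"
    by (auto simp: quotient_def)
  then show "{C \<in> A // r. C \<subseteq> B} \<lesssim> (UNIV :: 'i set)"
    using A by (meson image_lepoll lepoll_trans subset_imp_lepoll)
  have "inj (\<lambda>i. r `` {F i})"
    using F(2) inj by (intro injI) blast
  moreover have "range (\<lambda>i. r `` {F i}) \<subseteq> {C \<in> A // r. C \<subseteq> B}"
    using F(1,3) by (auto intro: quotientI)
  ultimately show "(UNIV :: 'i set) \<lesssim> {C \<in> A // r. C \<subseteq> B}"
    unfolding lepoll_def by blast
qed

section \<open>The endomorphism monoid\<close>

lemma End_carrier_iff: "f \<in> carrier (End D) \<longleftrightarrow> f \<in> extensional (verts D) \<and> digraph_hom D D f"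
  by (simp add: End_def)

lemma End_mult: "f \<otimes>\<^bsub>End D\<^esub> g = (\<lambda>x\<in>verts D. g (f x))"
  by (simp add: End_def compose_def)

lemma End_one: "\<one>\<^bsub>End D\<^esub> = (\<lambda>x\<in>verts D. x)"
  by (simp add: End_def)

lemma End_apply_closed: "f \<in> carrier (End D) \<Longrightarrow> x \<in> verts D \<Longrightarrow> f x \<in> verts D"
  by (auto simp: End_carrier_iff digraph_hom_def)

lemma End_eqI:
  assumes "f \<in> carrier (End D)" "g \<in> carrier (End D)" "\<And>x. x \<in> verts D \<Longrightarrow> f x = g x"
  shows "f = g"
  using assms by (auto simp: End_carrier_iff intro: extensionalityI)

lemma restrict_End_iff:
  assumes "digraph D"
  shows "restrict f (verts D) \<in> carrier (End D) \<longleftrightarrow> digraph_hom D D f"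
proof -
  have "(\<forall>(u, v)\<in>edges D. (restrict f (verts D) u, restrict f (verts D) v) \<in> edges D) \<longleftrightarrow>
      (\<forall>(u, v)\<in>edges D. (f u, f v) \<in> edges D)"
    using digraph_edgeD[OF assms] by (intro ball_cong) auto
  then show ?thesis
    by (simp add: End_carrier_iff digraph_hom_def Pi_iff)
qed

lemma monoid_End:
  assumes "digraph D"
  shows "monoid (End D)"
proof
  show mult: "f \<otimes>\<^bsub>End D\<^esub> g \<in> carrier (End D)"
    if "f \<in> carrier (End D)" "g \<in> carrier (End D)" for f g
    using that digraph_hom_comp[of D D f D g]
    unfolding End_mult restrict_End_iff[OF assms] by (simp add: End_carrier_iff comp_def)
  show one: "\<one>\<^bsub>End D\<^esub> \<in> carrier (End D)"
    unfolding End_one restrict_End_iff[OF assms] by (simp add: digraph_hom_def)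
  show "f \<otimes>\<^bsub>End D\<^esub> g \<otimes>\<^bsub>End D\<^esub> h = f \<otimes>\<^bsub>End D\<^esub> (g \<otimes>\<^bsub>End D\<^esub> h)"
    if "f \<in> carrier (End D)" "g \<in> carrier (End D)" "h \<in> carrier (End D)" for f g h
    using End_apply_closed[OF that(1)] by (auto simp: End_mult)
  show "\<one>\<^bsub>End D\<^esub> \<otimes>\<^bsub>End D\<^esub> f = f" "f \<otimes>\<^bsub>End D\<^esub> \<one>\<^bsub>End D\<^esub> = f" if f: "f \<in> carrier (End D)" for f
    using mult[OF one f] mult[OF f one] f End_apply_closed[OF f]
    by (auto intro!: End_eqI[where D = D] simp: End_mult End_one)
qed

lemma green_R_End_imp_same_kernel:
  assumes "digraph D" "(f, g) \<in> green_R (End D)" "x \<in> verts D" "y \<in> verts D"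
  shows "f x = f y \<longleftrightarrow> g x = g y"
proof -
  obtain u v where "f = g \<otimes>\<^bsub>End D\<^esub> u" "g = f \<otimes>\<^bsub>End D\<^esub> v"
    using assms(2) monoid.green_R_iff[OF monoid_End[OF assms(1)]] by blast
  then have "f x = u (g x)" "f y = u (g y)" "g x = v (f x)" "g y = v (f y)"
    using assms(3,4) unfolding End_mult by (metis restrict_apply')+
  then show ?thesis
    by metis
qed

lemma green_L_End_imp_same_image:
  assumes "digraph D" "(f, g) \<in> green_L (End D)"
  shows "f ` verts D = g ` verts D"
proof -
  obtain u v where u: "u \<in> carrier (End D)" "f = u \<otimes>\<^bsub>End D\<^esub> g"
    and v: "v \<in> carrier (End D)" "g = v \<otimes>\<^bsub>End D\<^esub> f"
    using assms(2) monoid.green_L_iff[OF monoid_End[OF assms(1)]] by blast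
  have image: "(w \<otimes>\<^bsub>End D\<^esub> h) ` verts D \<subseteq> h ` verts D" if "w \<in> carrier (End D)" for w h
    using End_apply_closed[OF that] by (auto simp: End_mult)
  show ?thesis
    using image[OF u(1), of g] image[OF v(1), of f]
    unfolding u(2)[symmetric] v(2)[symmetric] by (rule equalityI)
qed

lemma regular_injective_imp_embedding:
  assumes "regular_element (End D) f" "inj_on f (verts D)"
  shows "digraph_embedding D D f"
proof -
  obtain g where f: "f \<in> carrier (End D)" and g: "g \<in> carrier (End D)"
    and fgf: "f \<otimes>\<^bsub>End D\<^esub> g \<otimes>\<^bsub>End D\<^esub> f = f"
    using assms(1) by (auto simp: regular_element_def)
  have gf: "g (f x) = x" if x: "x \<in> verts D" for x
  proof (rule inj_onD[OF assms(2)])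
    show "f (g (f x)) = f x"
      using fun_cong[OF fgf, of x] x by (simp add: End_mult)
  qed (use x End_apply_closed[OF g End_apply_closed[OF f x]] in auto)
  have "(u, v) \<in> edges D \<longleftrightarrow> (f u, f v) \<in> edges D" if "u \<in> verts D" "v \<in> verts D" for u v
    using digraph_homD(2)[of D D] f g gf that unfolding End_carrier_iff by metis
  then show ?thesis
    using f assms(2) by (simp add: digraph_embedding_def End_carrier_iff digraph_hom_def)
qed

lemma PiE_lepoll_UNIV_nat_set:
  assumes "countable A" "countable B"
  shows "A \<rightarrow>\<^sub>E B \<lesssim> (UNIV :: nat set set)"
proof -
  let ?graph = "\<lambda>f. (\<lambda>x. (x, f x)) ` A"
  have "inj_on ?graph (A \<rightarrow>\<^sub>E B)"
    by (intro inj_onI PiE_ext) auto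
  moreover have "inj_on (image (to_nat_on (A \<times> B))) (?graph ` (A \<rightarrow>\<^sub>E B))"
    using assms by (intro inj_on_image inj_on_subset[OF inj_on_to_nat_on]) auto
  ultimately show ?thesis
    unfolding lepoll_def by (meson comp_inj_on subset_UNIV)
qed

lemma End_lepoll_UNIV_nat_set:
  assumes "countable (verts D)"
  shows "carrier (End D) \<lesssim> (UNIV :: nat set set)"
proof -
  have "carrier (End D) \<subseteq> verts D \<rightarrow>\<^sub>E verts D"
    by (auto simp: End_carrier_iff digraph_hom_def PiE_def)
  then show ?thesis
    using PiE_lepoll_UNIV_nat_set[OF assms assms] by (meson lepoll_trans subset_imp_lepoll)
qed

section \<open>Classes within the class of an injective endomorphism\<close>

definition adjoin_isolated :: "'a digraph \<Rightarrow> ('a + nat) digraph" where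
  "adjoin_isolated G = (Inl ` verts G \<union> range Inr, map_prod Inl Inl ` edges G)"

lemma digraph_adjoin_isolated: "digraph G \<Longrightarrow> digraph (adjoin_isolated G)"
  by (auto simp: digraph_def adjoin_isolated_def irrefl_def)

lemma countable_adjoin_isolated: "countable (verts G) \<Longrightarrow> countable (verts (adjoin_isolated G))"
  by (simp add: adjoin_isolated_def)

lemma digraph_hom_case_sum_adjoin_isolated:
  assumes "digraph_hom G H p" "range c \<subseteq> verts H"
  shows "digraph_hom (adjoin_isolated G) H (case_sum p c)"
  using assms(2) digraph_homD[OF assms(1)] by (auto simp: digraph_hom_def adjoin_isolated_def)

lemma digraph_embedding_Inl_adjoin_isolated: "digraph_embedding G (adjoin_isolated G) Inl"
  by (auto simp: digraph_embedding_def adjoin_isolated_def)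

context generic_digraph
begin

sublocale End: monoid "End D"
  by (rule monoid_End[OF digraph])

lemma ex_retraction_with_prescribed_values:
  assumes e: "digraph_embedding (adjoin_isolated D) D e" "finitely_attached (adjoin_isolated D) D e"
    and c: "range c \<subseteq> verts D"
  obtains h where "digraph_hom D D h" "\<And>x. x \<in> verts D \<Longrightarrow> h (e (Inl x)) = x" "\<And>n. h (e (Inr n)) = c n"
proof -
  have "digraph_hom (adjoin_isolated D) D (case_sum (\<lambda>x. x) c)"
    by (rule digraph_hom_case_sum_adjoin_isolated[OF _ c]) (auto simp: digraph_hom_def)
  then obtain h where h: "digraph_hom D D h"
    "\<And>v. v \<in> verts (adjoin_isolated D) \<Longrightarrow> h (e v) = case_sum (\<lambda>x. x) c v"
    by (rule hom_extends_along_finitely_attached_embedding[OF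
          digraph countable_verts algebraically_closed e]) blast
  show ?thesis
    by (rule that[OF h(1)]) (simp_all add: h(2) adjoin_isolated_def)
qed

lemma ex_retractions_with_independent_kernels:
  obtains s h a z where "s \<in> carrier (End D)" "\<And>S. h S \<in> carrier (End D)"
    "\<And>S. s \<otimes>\<^bsub>End D\<^esub> h S = \<one>\<^bsub>End D\<^esub>" "a \<in> verts D" "\<And>n. z n \<in> verts D"
    "\<And>S (n :: nat). h S (z n) = h S a \<longleftrightarrow> n \<in> S"
proof -
  obtain a b where "(a, b) \<in> edges D"
    by (rule ex_edge)
  note ab = digraph_edgeD[OF digraph this]
  obtain e where e: "digraph_embedding (adjoin_isolated D) D e"
    "finitely_attached (adjoin_isolated D) D e"
    by (rule ex_finitely_attached_embedding[OF digraph_adjoin_isolated[OF digraph]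
          countable_adjoin_isolated[OF countable_verts]])
  have e_closed: "x \<in> verts D \<Longrightarrow> e (Inl x) \<in> verts D" "e (Inr n) \<in> verts D" for x n
    using e(1) by (auto simp: digraph_embedding_def adjoin_isolated_def)
  have "\<exists>h. digraph_hom D D h \<and> (\<forall>x\<in>verts D. h (e (Inl x)) = x) \<and>
      (\<forall>n. h (e (Inr n)) = (if n \<in> S then a else b))" for S
    by (rule ex_retraction_with_prescribed_values[OF e, of "\<lambda>n. if n \<in> S then a else b"])
      (use ab in auto)
  then obtain h where h: "\<And>S. digraph_hom D D (h S)" "\<And>S x. x \<in> verts D \<Longrightarrow> h S (e (Inl x)) = x"
    "\<And>S n. h S (e (Inr n)) = (if n \<in> S then a else b)"
    by metis
  show ?thesis
  proof
    show "restrict (e \<circ> Inl) (verts D) \<in> carrier (End D)"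
      unfolding restrict_End_iff[OF digraph]
      by (rule digraph_embedding_imp_hom[OF digraph
            digraph_embedding_comp[OF digraph_embedding_Inl_adjoin_isolated e(1)]])
    show "restrict (h S) (verts D) \<in> carrier (End D)" for S
      unfolding restrict_End_iff[OF digraph] by (rule h(1))
    show "restrict (e \<circ> Inl) (verts D) \<otimes>\<^bsub>End D\<^esub> restrict (h S) (verts D) = \<one>\<^bsub>End D\<^esub>" for S
      unfolding End_mult End_one using h(2) e_closed(1) by (intro restrict_ext) simp
    show "e (Inl a) \<in> verts D" "(e \<circ> Inr) n \<in> verts D" for n
      using e_closed ab(1) by auto
    show "restrict (h S) (verts D) ((e \<circ> Inr) n) = restrict (h S) (verts D) (e (Inl a)) \<longleftrightarrow> n \<in> S" for S n
      using e_closed h(2,3) ab by simp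
  qed
qed

lemma R_classes_of_injective_endomorphism:
  assumes f: "f \<in> carrier (End D)" "inj_on f (verts D)"
  shows "{C \<in> carrier (End D) // green_R (End D). C \<subseteq> green_D (End D) `` {f}} \<approx> (UNIV :: nat set set)"
proof -
  obtain s h a z where s: "s \<in> carrier (End D)" and h: "\<And>S. h S \<in> carrier (End D)"
    and split: "\<And>S. s \<otimes>\<^bsub>End D\<^esub> h S = \<one>\<^bsub>End D\<^esub>" and a: "a \<in> verts D" and z: "\<And>n. z n \<in> verts D"
    and kernel: "\<And>S (n :: nat). h S (z n) = h S a \<longleftrightarrow> n \<in> S"
    using ex_retractions_with_independent_kernels by blast
  show ?thesis
  proof (rule quotient_classes_eqpoll_UNIV[where F = "\<lambda>S. h S \<otimes>\<^bsub>End D\<^esub> f"])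
    show "carrier (End D) \<lesssim> (UNIV :: nat set set)"
      by (rule End_lepoll_UNIV_nat_set[OF countable_verts])
    show closed: "h S \<otimes>\<^bsub>End D\<^esub> f \<in> carrier (End D)" for S
      using h f(1) by blast
    show "(h S \<otimes>\<^bsub>End D\<^esub> f, h S \<otimes>\<^bsub>End D\<^esub> f) \<in> green_R (End D)" for S
      using closed by (simp add: green_R_def)
    show "green_R (End D) `` {h S \<otimes>\<^bsub>End D\<^esub> f} \<subseteq> green_D (End D) `` {f}" for S
      using End.green_L_mult_split[OF s h f(1) split] unfolding green_D_def by blast
    have kernel_mult: "(h S \<otimes>\<^bsub>End D\<^esub> f) (z n) = (h S \<otimes>\<^bsub>End D\<^esub> f) a \<longleftrightarrow> n \<in> S" for S n
      using kernel inj_on_eq_iff[OF f(2) End_apply_closed[OF h z] End_apply_closed[OF h a]] z a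
      by (simp add: End_mult)
    show "S = T" if "(h S \<otimes>\<^bsub>End D\<^esub> f, h T \<otimes>\<^bsub>End D\<^esub> f) \<in> green_R (End D)" for S T
      using green_R_End_imp_same_kernel[OF digraph that z a] unfolding kernel_mult by blast
  qed
qed

end

definition blow_up :: "'a digraph \<Rightarrow> ('a \<times> 'i) digraph" where
  "blow_up G = (verts G \<times> UNIV, {((x, i), (y, j)). (x, y) \<in> edges G})"

lemma digraph_blow_up: "digraph G \<Longrightarrow> digraph (blow_up G)"
  by (auto simp: digraph_def blow_up_def irrefl_def)

lemma countable_blow_up:
  "countable (verts G) \<Longrightarrow> countable (verts (blow_up G :: ('a \<times> 'i :: countable) digraph))"
  by (simp add: blow_up_def)

lemma digraph_embedding_blow_up: "digraph_embedding G (blow_up G) (\<lambda>x. (x, c x))"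
  by (auto simp: digraph_embedding_def blow_up_def inj_on_def)

lemma digraph_hom_blow_up_collapse: "digraph_hom (blow_up G) G fst"
  by (auto simp: digraph_hom_def blow_up_def)

locale doubled_digraph_in_generic = generic_digraph D for D :: "'a digraph" +
  fixes \<Gamma> :: "'b digraph" and q :: "'a \<Rightarrow> 'b" and e :: "'b \<times> bool \<Rightarrow> 'a"
  assumes \<Gamma>: "digraph \<Gamma>"
    and q: "digraph_hom D \<Gamma> q" "bij_betw q (verts D) (verts \<Gamma>)"
    and e: "digraph_embedding (blow_up \<Gamma>) D e" "finitely_attached (blow_up \<Gamma>) D e"
begin

definition twin_copy :: "('b \<Rightarrow> bool) \<Rightarrow> 'b \<Rightarrow> 'a" where
  "twin_copy c = (\<lambda>y. e (y, c y))"

definition twin_endomorphism :: "('b \<Rightarrow> bool) \<Rightarrow> 'a \<Rightarrow> 'a" where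
  "twin_endomorphism c = restrict (twin_copy c \<circ> q) (verts D)"

lemma twin_copy_embedding: "digraph_embedding \<Gamma> D (twin_copy c)"
  using digraph_embedding_comp[OF digraph_embedding_blow_up e(1)] by (simp add: comp_def twin_copy_def)

lemma twin_copy_eq_iff:
  assumes "y \<in> verts \<Gamma>" "y' \<in> verts \<Gamma>"
  shows "twin_copy c y = twin_copy c' y' \<longleftrightarrow> y = y' \<and> c y = c' y'"
  using digraph_embeddingD(2)[OF e(1), of "(y, c y)" "(y', c' y')"] assms
  by (simp add: blow_up_def twin_copy_def)

lemma twin_endomorphism_End: "twin_endomorphism c \<in> carrier (End D)"
  using digraph_hom_comp[OF q(1) digraph_embedding_imp_hom[OF \<Gamma> twin_copy_embedding]]
  unfolding twin_endomorphism_def restrict_End_iff[OF digraph] .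

lemma inj_on_twin_endomorphism: "inj_on (twin_endomorphism c) (verts D)"
  using comp_inj_on[of q "verts D" "twin_copy c"] q(2) twin_copy_embedding[of c]
  by (simp add: twin_endomorphism_def bij_betw_def digraph_embedding_def)

lemma image_twin_endomorphism: "twin_endomorphism c ` verts D = twin_copy c ` verts \<Gamma>"
  using image_comp[of "twin_copy c" q "verts D"] bij_betw_imp_surj_on[OF q(2)]
  by (simp add: twin_endomorphism_def)

lemma isomorphic_image_twin_endomorphism:
  "isomorphic (induced_subgraph D (twin_endomorphism c ` verts D)) \<Gamma>"
  unfolding image_twin_endomorphism
  by (rule isomorphic_sym[OF digraph_embedding_imp_isomorphic_image[OF twin_copy_embedding]])

lemma twin_endomorphism_not_regular:
  assumes "\<not> isomorphic \<Gamma> D"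
  shows "\<not> regular_element (End D) (twin_endomorphism c)"
proof
  assume "regular_element (End D) (twin_endomorphism c)"
  then have "isomorphic D (induced_subgraph D (twin_endomorphism c ` verts D))"
    using regular_injective_imp_embedding[OF _ inj_on_twin_endomorphism]
    by (blast intro: digraph_embedding_imp_isomorphic_image)
  then show False
    using assms isomorphic_image_twin_endomorphism isomorphic_trans isomorphic_sym by blast
qed

lemma twin_endomorphisms_green_R: "(twin_endomorphism c, twin_endomorphism c') \<in> green_R (End D)"
proof -
  have "\<exists>u\<in>carrier (End D). twin_endomorphism c = twin_endomorphism c' \<otimes>\<^bsub>End D\<^esub> u" for c c'
  proof -
    have "digraph_hom (blow_up \<Gamma>) D (twin_copy c \<circ> fst)"
      by (rule digraph_hom_comp[OF digraph_hom_blow_up_collapse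
            digraph_embedding_imp_hom[OF \<Gamma> twin_copy_embedding]])
    then obtain h where h: "digraph_hom D D h"
      "\<And>z. z \<in> verts (blow_up \<Gamma>) \<Longrightarrow> h (e z) = (twin_copy c \<circ> fst) z"
      using hom_extends_along_finitely_attached_embedding[OF
          digraph countable_verts algebraically_closed e]
      by metis
    have u: "restrict h (verts D) \<in> carrier (End D)"
      using h(1) restrict_End_iff[OF digraph] by blast
    have "twin_endomorphism c = twin_endomorphism c' \<otimes>\<^bsub>End D\<^esub> restrict h (verts D)"
    proof (rule End_eqI[OF twin_endomorphism_End End.m_closed[OF twin_endomorphism_End u]])
      fix x assume x: "x \<in> verts D"
      then have "h (twin_copy c' (q x)) = twin_copy c (q x)"
        using h(2)[of "(q x, c' (q x))"] digraph_homD(1)[OF q(1)]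
        by (simp add: blow_up_def twin_copy_def)
      then show "twin_endomorphism c x = (twin_endomorphism c' \<otimes>\<^bsub>End D\<^esub> restrict h (verts D)) x"
        using x End_apply_closed[OF twin_endomorphism_End x, of c']
        by (simp add: End_mult twin_endomorphism_def)
    qed
    then show ?thesis
      using u by blast
  qed
  then show ?thesis
    unfolding End.green_R_iff using twin_endomorphism_End by blast
qed

lemma twin_endomorphisms_green_L_imp_eq:
  assumes "(twin_endomorphism c, twin_endomorphism c') \<in> green_L (End D)" "y \<in> verts \<Gamma>"
  shows "c y = c' y"
proof -
  have "twin_copy c y \<in> twin_copy c' ` verts \<Gamma>"
    using green_L_End_imp_same_image[OF digraph assms(1)] assms(2)
    unfolding image_twin_endomorphism by blast
  then show ?thesis
    using twin_copy_eq_iff[OF assms(2)] by auto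
qed

lemma L_classes_of_twin_endomorphism:
  assumes "countable (verts \<Gamma>)" "infinite (verts \<Gamma>)"
  shows "{C \<in> carrier (End D) // green_L (End D). C \<subseteq> green_D (End D) `` {twin_endomorphism c}} \<approx>
    (UNIV :: nat set set)"
proof -
  let ?t = "to_nat_on (verts \<Gamma>)"
  let ?F = "\<lambda>S. twin_endomorphism (\<lambda>y. ?t y \<in> S)"
  show ?thesis
  proof (rule quotient_classes_eqpoll_UNIV[where F = ?F])
    show "carrier (End D) \<lesssim> (UNIV :: nat set set)"
      by (rule End_lepoll_UNIV_nat_set[OF countable_verts])
    show "?F S \<in> carrier (End D)" for S
      by (rule twin_endomorphism_End)
    show "(?F S, ?F S) \<in> green_L (End D)" for S
      using twin_endomorphism_End by (simp add: green_L_def)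
    show "green_L (End D) `` {?F S} \<subseteq> green_D (End D) `` {twin_endomorphism c}" for S
      using End.green_R_O_green_L_subset_green_D twin_endomorphisms_green_R by blast
    show "S = T" if "(?F S, ?F T) \<in> green_L (End D)" for S T
    proof -
      have "\<forall>n\<in>?t ` verts \<Gamma>. n \<in> S \<longleftrightarrow> n \<in> T"
        using twin_endomorphisms_green_L_imp_eq[OF that] by blast
      then show ?thesis
        using bij_betw_imp_surj_on[OF to_nat_on_infinite[OF assms]] by blast
    qed
  qed
qed

end

theorem theorem4p7:
  fixes D :: "'a digraph" and \<Gamma> :: "'b digraph"
  assumes "universal_digraph D"
    and "digraph \<Gamma>" and "countable (verts \<Gamma>)"
    and "algebraically_closed \<Gamma>"
    and "\<not> isomorphic \<Gamma> D"
  shows "\<exists>f\<in>carrier (End D).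
    \<not> regular_element (End D) f \<and>
    inj_on f (verts D) \<and>
    isomorphic (induced_subgraph D (f ` verts D)) \<Gamma> \<and>
    {C \<in> carrier (End D) // green_R (End D). C \<subseteq> green_D (End D) `` {f}} \<approx> (UNIV :: nat set set) \<and>
    {C \<in> carrier (End D) // green_L (End D). C \<subseteq> green_D (End D) `` {f}} \<approx> (UNIV :: nat set set)"
proof -
  interpret generic_digraph D
    by (rule universal_digraph_imp_generic[OF assms(1)])
  obtain q where q: "digraph_hom D \<Gamma> q" "bij_betw q (verts D) (verts \<Gamma>)"
    by (rule ex_bijective_hom[OF assms(2-4)])
  obtain e :: "'b \<times> bool \<Rightarrow> 'a"
    where e: "digraph_embedding (blow_up \<Gamma>) D e" "finitely_attached (blow_up \<Gamma>) D e"
    by (rule ex_finitely_attached_embedding[OF digraph_blow_up[OF assms(2)]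
          countable_blow_up[OF assms(3)]])
  interpret doubled_digraph_in_generic D \<Gamma> q e
    by unfold_locales (fact assms(2) q e)+
  let ?f = "twin_endomorphism (\<lambda>_. False)"
  show ?thesis
  proof (intro bexI conjI)
    show f: "?f \<in> carrier (End D)" and inj: "inj_on ?f (verts D)"
      by (rule twin_endomorphism_End inj_on_twin_endomorphism)+
    show "\<not> regular_element (End D) ?f"
      by (rule twin_endomorphism_not_regular[OF assms(5)])
    show "isomorphic (induced_subgraph D (?f ` verts D)) \<Gamma>"
      by (rule isomorphic_image_twin_endomorphism)
    show "{C \<in> carrier (End D) // green_R (End D). C \<subseteq> green_D (End D) `` {?f}} \<approx> (UNIV :: nat set set)"
      by (rule R_classes_of_injective_endomorphism[OF f inj])
    show "{C \<in> carrier (End D) // green_L (End D). C \<subseteq> green_D (End D) `` {?f}} \<approx> (UNIV :: nat set set)"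
      by (rule L_classes_of_twin_endomorphism[OF assms(3) algebraically_closed_infinite[OF assms(2,4)]])
  qed
qed

end
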